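(* Let $F\colon\mathbb{R}^d\to\mathbb{R}^d$ be a differentiable operator with Jacobian $\partial F(x)$ at $x$, and let $J,H\ge 0$ and $c>0$ be constants such that for all $x,y\in\mathbb{R}^d$ it holds $\|\partial F(x)\|\le J$ and $$\|F(y)-F(x)-\partial F(x)(y-x)\|\le H\|x-y\|^2,$$ $$\|F(y)\|^2\le\|F(x)+\partial F(x)(y-x)\|^2+c\|y-x\|^3.$$ Let $x^0\in\mathbb{R}^d$ and let $(x^k)_{k\ge0}$ be generated by $$\mathbf{J}_k=\partial F(x^k),\qquad \lambda_k=\sqrt{c\|\mathbf{J}_k^\top F(x^k)\|},\qquad x^{k+1}=x^k-\bigl(\mathbf{J}_k^\top\mathbf{J}_k+\lambda_k\mathbf{I}\bigr)^{-1}\mathbf{J}_k^\top F(x^k),\qquad k=0,1,2,\dots,$$ where the matrices $\mathbf{J}_k^\top\mathbf{J}_k+\lambda_k\mathbf{I}$ are assumed invertible for all $k$, so that the iteration is defined. Then $$\|F(x^{k+1})\|\le\|F(x^k)\|\ \text{ for all }k\ge0\qquad\text{and}\qquad \min_{t\le k}\|\mathbf{J}_t^\top F(x^t)\|=\mathcal{O}\left(\frac{\log k}{k^{2/5}}\right).$$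
   Context: $\|\cdot\|$ is the Euclidean norm on vectors and the induced operator norm on matrices; $\mathbf{I}$ is the identity matrix. The minimum is over $t\in\{0,1,\dots,k\}$. The notation $\mathcal{O}(\cdot)$ is the non-asymptotic big-O that hides all constants and keeps only the dependence on $k$: the last conclusion means that there is a constant $C$ not depending on $k$ such that $\min_{t\le k}\|\mathbf{J}_t^\top F(x^t)\|\le C\log k/k^{2/5}$ for all $k\ge2$. *)

theory Defs
  imports "HOL-Analysis.Analysis"
begin

(* The library's norm on the type of matrices is the Frobenius norm, hence a
   separate constant for the norm induced by the Euclidean norm on vectors. *)
definition matrix_opnorm :: "real ^ 'n ^ 'm \<Rightarrow> real" where
  "matrix_opnorm A = onorm (\<lambda>v. A *v v)"

end

theory Submission
  imports Defs
begin

text \<open>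
  Write \<open>g\<close>, \<open>\<lambda>\<close>, \<open>s\<close> for the gradient, the regularization and the step at \<open>x\<^sup>k\<close>. Pairing the normal
  equation \<open>J\<^sup>T J s + \<lambda> s = - g\<close> with \<open>s\<close> gives \<open>\<lambda> \<parallel>s\<parallel> \<le> \<parallel>g\<parallel> = \<lambda>\<^sup>2 / c\<close>, so that the cubic error is
  at most \<open>\<lambda> \<parallel>s\<parallel>\<^sup>2\<close> and \<open>\<parallel>F\<parallel>\<^sup>2\<close> decreases by at least \<open>\<parallel>J s\<parallel>\<^sup>2 + \<lambda> \<parallel>s\<parallel>\<^sup>2\<close>. The normal equation also
  bounds \<open>\<parallel>g\<parallel>\<close> by \<open>\<parallel>J\<parallel> \<parallel>J s\<parallel> + \<surd>\<lambda> (\<surd>\<lambda> \<parallel>s\<parallel>)\<close>, and \<open>\<lambda>\<close> stays bounded, so \<open>\<parallel>g\<parallel>\<^sup>2\<close> is at most a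
  constant times the decrease of \<open>\<parallel>F\<parallel>\<^sup>2\<close>. Telescoping yields a minimum of order \<open>k\<^bsup>-1/2\<^esup>\<close>, which is
  stronger than the claimed rate.
\<close>

lemma norm_mult_le_matrix_opnorm: "norm (A *v v) \<le> matrix_opnorm A * norm v"
  unfolding matrix_opnorm_def by (rule onorm) simp

lemma matrix_opnorm_nonneg: "matrix_opnorm A \<ge> 0"
  unfolding matrix_opnorm_def by (rule onorm_pos_le) simp

text \<open>Moving one transpose across the inner product and applying Cauchy-Schwarz bounds the
  square of the left side by the right side times the left side; a nonzero left side then
  cancels.\<close>

lemma norm_transpose_mult_le_matrix_opnorm:
  "norm (transpose A *v v) \<le> matrix_opnorm A * norm v"
proof (cases "transpose A *v v = 0")
  case True
  then show ?thesis
    by (simp add: matrix_opnorm_nonneg)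
next
  case False
  have "norm (transpose A *v v) ^ 2 = v \<bullet> (A *v (transpose A *v v))"
    by (metis dot_lmul_matrix power2_norm_eq_inner transpose_matrix_vector)
  also have "\<dots> \<le> norm v * norm (A *v (transpose A *v v))"
    by (rule norm_cauchy_schwarz)
  also have "\<dots> \<le> norm v * (matrix_opnorm A * norm (transpose A *v v))"
    by (intro mult_left_mono norm_mult_le_matrix_opnorm) auto
  finally have "norm (transpose A *v v) * norm (transpose A *v v)
      \<le> (matrix_opnorm A * norm v) * norm (transpose A *v v)"
    by (simp only: power2_eq_square mult_ac)
  then show ?thesis
    by (rule mult_right_le_imp_le) (use False in simp)
qed

lemma regularized_step_normal_equation:
  fixes A :: "real ^ 'n ^ 'm"
  assumes "invertible (transpose A ** A + l *\<^sub>R mat 1)"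
    and s: "s = - (matrix_inv (transpose A ** A + l *\<^sub>R mat 1) *v g)"
  shows "transpose A *v (A *v s) + l *\<^sub>R s = - g"
proof -
  let ?B = "transpose A ** A + l *\<^sub>R mat 1"
  \<comment> \<open>\<open>matrix_inv\<close> is a Hilbert choice, so its inverse property has to be
    drawn from invertibility.\<close>
  have "?B ** matrix_inv ?B = mat 1"
    using assms(1) unfolding invertible_def matrix_inv_def by (rule someI2_ex) simp
  moreover have "?B *v s = - ((?B ** matrix_inv ?B) *v g)"
    unfolding s matrix_vector_mul_assoc[symmetric]
    by (rule linear_neg) (rule matrix_vector_mul_linear)
  ultimately have "?B *v s = - g"
    by simp
  then show ?thesis
    by (simp add: matrix_vector_mult_add_rdistrib matrix_vector_mul_assoc[symmetric]
        scaleR_matrix_vector_assoc[symmetric])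
qed

text \<open>Expanding the square gives the cross term \<open>2 * (g \<bullet> s)\<close>. One copy
  of \<open>g \<bullet> s\<close> cancels \<open>(norm (A *v s))\<^sup>2\<close> and absorbs the
  cubic term; the other is the decrease.\<close>

lemma regularized_step_decrease:
  fixes A :: "real ^ 'n ^ 'm"
  assumes "c > 0"
    and g: "g = transpose A *v b"
    and l: "l = sqrt (c * norm g)"
    and inv: "invertible (transpose A ** A + l *\<^sub>R mat 1)"
    and s: "s = - (matrix_inv (transpose A ** A + l *\<^sub>R mat 1) *v g)"
  shows "(norm (b + A *v s))\<^sup>2 + c * norm s ^ 3
           \<le> (norm b)\<^sup>2 - ((norm (A *v s))\<^sup>2 + l * (norm s)\<^sup>2)"
proof -
  have l0: "l \<ge> 0" using assms by simp
  have l2: "l * l = c * norm g" using assms by simp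
  have "g \<bullet> s = - ((transpose A *v (A *v s) + l *\<^sub>R s) \<bullet> s)"
    using regularized_step_normal_equation[OF inv s] by simp
  also have "\<dots> = - ((norm (A *v s))\<^sup>2 + l * (norm s)\<^sup>2)"
    by (simp add: inner_add_left power2_norm_eq_inner dot_lmul_matrix transpose_matrix_vector)
  finally have gs: "g \<bullet> s = - ((norm (A *v s))\<^sup>2 + l * (norm s)\<^sup>2)" .
  have cs: "c * norm s \<le> l"
  proof (cases "l = 0 \<or> s = 0")
    case True
    \<comment> \<open>Division by \<open>l\<close> is impossible here, but \<open>l = 0\<close>
      forces \<open>g = 0\<close> and hence \<open>s = 0\<close>.\<close>
    have "l = 0 \<Longrightarrow> g = 0" using l2 \<open>c > 0\<close> by simp
    with True s l0 show ?thesis by auto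
  next
    case False
    have "l * (norm s)\<^sup>2 \<le> norm g * norm s"
      using norm_cauchy_schwarz[of "- g" s] gs zero_le_power2[of "norm (A *v s)"]
      unfolding inner_minus_left norm_minus_cancel by linarith
    then have "l * norm s \<le> norm g" using False by (simp add: power2_eq_square mult.assoc[symmetric])
    then have "c * (l * norm s) \<le> l * l" using l2 \<open>c > 0\<close> by simp
    then have "l * (c * norm s) \<le> l * l" by (simp add: mult.left_commute)
    then show ?thesis using False l0 by simp
  qed
  have "c * norm s ^ 3 = (c * norm s) * (norm s)\<^sup>2"
    by (simp add: power2_eq_square power3_eq_cube)
  also have "\<dots> \<le> l * (norm s)\<^sup>2"
    using cs by (simp add: mult_right_mono)
  finally have "c * norm s ^ 3 \<le> l * (norm s)\<^sup>2" .
  moreover have "g \<bullet> s = b \<bullet> (A *v s)"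
    by (simp add: g dot_lmul_matrix)
  then have "(norm (b + A *v s))\<^sup>2 = (norm b)\<^sup>2 + 2 * (g \<bullet> s) + (norm (A *v s))\<^sup>2"
    by (simp add: power2_norm_eq_inner inner_add inner_commute)
  ultimately show ?thesis using gs by simp
qed

lemma regularized_step_gradient_bound:
  fixes A :: "real ^ 'n ^ 'm"
  assumes "l \<ge> 0"
    and eq: "transpose A *v (A *v s) + l *\<^sub>R s = - g"
  shows "(norm g)\<^sup>2
           \<le> (matrix_opnorm A + sqrt l)\<^sup>2 * ((norm (A *v s))\<^sup>2 + l * (norm s)\<^sup>2)"
proof -
  define D where "D = (norm (A *v s))\<^sup>2 + l * (norm s)\<^sup>2"
  have D: "D \<ge> 0" using assms by (simp add: D_def)
  have "norm (A *v s) \<le> sqrt D"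
    using assms by (intro real_le_rsqrt) (simp add: D_def)
  moreover have "sqrt l * norm s \<le> sqrt D"
    using assms by (intro real_le_rsqrt) (simp add: D_def power_mult_distrib)
  moreover have "norm g \<le> norm (transpose A *v (A *v s)) + l * norm s"
    using norm_triangle_ineq[of "transpose A *v (A *v s)" "l *\<^sub>R s"] assms by simp
  \<comment> \<open>One factor \<open>sqrt l\<close> joins \<open>norm s\<close> to be bounded by
    \<open>sqrt D\<close>; the other goes into the constant.\<close>
  moreover have "l * norm s = sqrt l * (sqrt l * norm s)"
    using assms by (simp add: mult.assoc[symmetric])
  moreover have "norm (transpose A *v (A *v s)) \<le> matrix_opnorm A * norm (A *v s)"
    by (rule norm_transpose_mult_le_matrix_opnorm)
  ultimately have "norm g \<le> matrix_opnorm A * sqrt D + sqrt l * sqrt D"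
    using matrix_opnorm_nonneg[of A] assms(1)
    by (smt (verit) mult_left_mono real_sqrt_ge_zero)
  then have "(norm g)\<^sup>2 \<le> ((matrix_opnorm A + sqrt l) * sqrt D)\<^sup>2"
    by (intro power_mono) (auto simp: algebra_simps)
  then show ?thesis
    using D by (simp add: power_mult_distrib D_def)
qed

lemma Min_image_le_of_square_decrease:
  fixes f u :: "nat \<Rightarrow> real"
  assumes "K \<ge> 0" and "\<And>t. f t \<ge> 0" and "\<And>t. u t \<ge> 0"
    and step: "\<And>t. (f t)\<^sup>2 \<le> K\<^sup>2 * (u t - u (Suc t))"
    and "k > 0"
  shows "Min (f ` {0..k}) \<le> K * sqrt (u 0) / sqrt (real k)"
proof -
  define m where "m = Min (f ` {0..k})"
  have "m \<in> f ` {0..k}" unfolding m_def by (rule Min_in) auto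
  then have m0: "m \<ge> 0" using assms(2) by auto
  \<comment> \<open>The indices \<open>t < k\<close> give exactly \<open>k\<close> terms, and their
    decreases telescope to \<open>u 0 - u k\<close>.\<close>
  have le: "m\<^sup>2 \<le> (f t)\<^sup>2" if "t < k" for t
    using m0 that by (intro power_mono) (auto simp: m_def)
  have "real k * m\<^sup>2 = (\<Sum>t<k. m\<^sup>2)" by simp
  also have "\<dots> \<le> (\<Sum>t<k. K\<^sup>2 * (u t - u (Suc t)))"
    by (rule sum_mono) (use le step order_trans in blast)
  also have "\<dots> = K\<^sup>2 * (u 0 - u k)"
    by (simp add: sum_distrib_left[symmetric] sum_lessThan_telescope')
  also have "\<dots> \<le> K\<^sup>2 * u 0"
    using assms(3) by (intro mult_left_mono) auto
  finally have "sqrt (real k * m\<^sup>2) \<le> sqrt (K\<^sup>2 * u 0)" by simp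
  then have "sqrt (real k) * m \<le> K * sqrt (u 0)"
    using m0 \<open>K \<ge> 0\<close> by (simp add: real_sqrt_mult)
  then show ?thesis
    using \<open>k > 0\<close> by (simp add: m_def field_simps)
qed

text \<open>Converts the rate obtained into the claimed one. The factor \<open>1 / ln 2\<close>
  comes from \<open>ln k \<ge> ln 2\<close>.\<close>

lemma inverse_sqrt_le_ln_over_powr:
  assumes "k \<ge> 2"
  shows "1 / sqrt (real k) \<le> (1 / ln 2) * (ln (real k) / real k powr (2/5))"
proof -
  have "1 / sqrt (real k) = 1 / real k powr (1/2)"
    using assms by (simp add: powr_half_sqrt)
  also have "\<dots> \<le> 1 / real k powr (2/5)"
    using assms by (intro divide_left_mono powr_mono) auto
  also have "\<dots> \<le> (ln (real k) / ln 2) / real k powr (2/5)"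
    using assms by (intro divide_right_mono) (auto simp: field_simps)
  finally show ?thesis by simp
qed

theorem theorem4:
  fixes F :: "real ^ 'd \<Rightarrow> real ^ 'd"
    and J H c :: real
    and x :: "nat \<Rightarrow> real ^ 'd"
    and Jac :: "nat \<Rightarrow> real ^ 'd ^ 'd"
    and lam :: "nat \<Rightarrow> real"
  assumes "\<And>y. F differentiable (at y)"
    and "J \<ge> 0" and "H \<ge> 0" and "c > 0"
    and "\<And>y. matrix_opnorm (jacobian F (at y)) \<le> J"
    and "\<And>y z. norm (F z - F y - jacobian F (at y) *v (z - y)) \<le> H * (norm (y - z))\<^sup>2"
    and "\<And>y z. (norm (F z))\<^sup>2
            \<le> (norm (F y + jacobian F (at y) *v (z - y)))\<^sup>2 + c * norm (z - y) ^ 3"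
    and "\<And>k. Jac k = jacobian F (at (x k))"
    and "\<And>k. lam k = sqrt (c * norm (transpose (Jac k) *v F (x k)))"
    and "\<And>k. invertible (transpose (Jac k) ** Jac k + lam k *\<^sub>R mat 1)"
    and "\<And>k. x (Suc k) = x k
            - matrix_inv (transpose (Jac k) ** Jac k + lam k *\<^sub>R mat 1)
                *v (transpose (Jac k) *v F (x k))"
  shows "(\<forall>k. norm (F (x (Suc k))) \<le> norm (F (x k))) \<and>
    (\<exists>C. \<forall>k\<ge>2. Min ((\<lambda>t. norm (transpose (Jac t) *v F (x t))) ` {0..k})
            \<le> C * (ln (real k) / real k powr (2/5)))"
proof -
  define g where "g t = transpose (Jac t) *v F (x t)" for t
  define s where "s t = x (Suc t) - x t" for t
  define D where "D t = (norm (Jac t *v s t))\<^sup>2 + lam t * (norm (s t))\<^sup>2" for t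
  note lam = assms(9)[folded g_def] and inv = assms(10)
  have s: "s t = - (matrix_inv (transpose (Jac t) ** Jac t + lam t *\<^sub>R mat 1) *v g t)" for t
    by (simp add: s_def g_def assms(11))
  have lam0: "lam t \<ge> 0" for t
    using \<open>c > 0\<close> by (simp add: lam)
  have decr: "D t \<le> (norm (F (x t)))\<^sup>2 - (norm (F (x (Suc t))))\<^sup>2" for t
  proof -
    have "(norm (F (x (Suc t))))\<^sup>2 \<le> (norm (F (x t) + Jac t *v s t))\<^sup>2 + c * norm (s t) ^ 3"
      using assms(7)[of "x (Suc t)" "x t"] by (simp add: s_def assms(8))
    with regularized_step_decrease[OF \<open>c > 0\<close> g_def lam inv s, of t] show ?thesis
      by (simp add: D_def)
  qed
  have D0: "D t \<ge> 0" for t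
    using lam0 by (simp add: D_def)
  have mono: "norm (F (x (Suc t))) \<le> norm (F (x t))" for t
    by (rule power2_le_imp_le[OF _ norm_ge_zero]) (use decr[of t] D0[of t] in linarith)
  have "norm (F (x t)) \<le> norm (F (x 0))" for t
    using lift_Suc_antimono_le[of "\<lambda>t. norm (F (x t))" 0 t] mono by simp
  then have g_bound: "norm (g t) \<le> J * norm (F (x 0))" for t
    using norm_transpose_mult_le_matrix_opnorm[of "Jac t" "F (x t)"]
      assms(5)[of "x t"] \<open>J \<ge> 0\<close>
    unfolding g_def assms(8) by (smt (verit) mult_mono norm_ge_zero)
  \<comment> \<open>The inner root bounds every \<open>lam t\<close>, by \<open>g_bound\<close>; the
    outer one turns this into a bound on \<open>sqrt (lam t)\<close>.\<close>
  define K where "K = J + sqrt (sqrt (c * (J * norm (F (x 0)))))"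
  have K0: "K \<ge> 0" using \<open>J \<ge> 0\<close> \<open>c > 0\<close> by (simp add: K_def)
  have "(norm (g t))\<^sup>2 \<le> K\<^sup>2 * ((norm (F (x t)))\<^sup>2 - (norm (F (x (Suc t))))\<^sup>2)" for t
  proof -
    have "(norm (g t))\<^sup>2 \<le> (matrix_opnorm (Jac t) + sqrt (lam t))\<^sup>2 * D t"
      unfolding D_def
      by (intro regularized_step_gradient_bound lam0 regularized_step_normal_equation inv s)
    also have "\<dots> \<le> K\<^sup>2 * D t"
    proof (intro mult_right_mono power_mono D0)
      have "sqrt (lam t) \<le> sqrt (sqrt (c * (J * norm (F (x 0)))))"
        using g_bound \<open>c > 0\<close> by (simp add: lam)
      then show "matrix_opnorm (Jac t) + sqrt (lam t) \<le> K"
        using assms(5)[of "x t"] unfolding K_def assms(8) by (rule add_mono[rotated])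
      show "0 \<le> matrix_opnorm (Jac t) + sqrt (lam t)"
        using lam0 by (simp add: matrix_opnorm_nonneg)
    qed
    also have "\<dots> \<le> K\<^sup>2 * ((norm (F (x t)))\<^sup>2 - (norm (F (x (Suc t))))\<^sup>2)"
      by (intro mult_left_mono decr) simp
    finally show ?thesis .
  qed
  then have rate: "Min ((\<lambda>t. norm (g t)) ` {0..k}) \<le> K * norm (F (x 0)) / sqrt (real k)"
    if "k \<ge> 2" for k
    \<comment> \<open>The potential is the squared residual, so \<open>sqrt (u 0)\<close> becomes
      \<open>norm (F (x 0))\<close>.\<close>
    using Min_image_le_of_square_decrease[of K "\<lambda>t. norm (g t)" "\<lambda>t. (norm (F (x t)))\<^sup>2" k]
      that K0 by simp
  have "Min ((\<lambda>t. norm (g t)) ` {0..k})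
      \<le> K * norm (F (x 0)) * (1 / ln 2) * (ln (real k) / real k powr (2/5))"
    if "k \<ge> 2" for k
    using rate[OF that] mult_left_mono[OF inverse_sqrt_le_ln_over_powr[OF that],
        of "K * norm (F (x 0))"] K0
    by (simp add: mult.assoc)
  then have "\<exists>C. \<forall>k\<ge>2. Min ((\<lambda>t. norm (g t)) ` {0..k}) \<le> C * (ln (real k) / real k powr (2/5))"
    by (intro exI allI impI)
  with mono show ?thesis
    unfolding g_def by simp
qed

end
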